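(* There exists a positive integer $N$ such that for every integer $k\ge 1$ and every integer $n\ge N$ we have $\overline{\min}\, e_k(K_n)=0$; that is, there is a rectilinear drawing of the complete graph $K_n$ in which no edge is involved in exactly $k$ crossings.
   Context: All graphs are simple and finite. A rectilinear drawing $\mathcal D$ of a graph represents the vertices by distinct points in the plane in general position (no three collinear) and every edge by the line segment joining its endpoints, with no three edges sharing an interior point. A crossing of $\mathcal D$ is a common interior point of two distinct edges. For an integer $k\ge 0$, $e_k(\mathcal D)$ is the number of edges of $\mathcal D$ that are involved in exactly $k$ crossings. $\overline{\min}\, e_k(G)$ is the minimum of $e_k(\mathcal D)$ over all rectilinear drawings $\mathcal D$ of $G$. *)

theory Defs
  imports "HOL-Analysis.Analysis" "HOL-Library.Ramsey"
begin

text \<open>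
  A finite simple graph is given by a finite vertex set \<open>V\<close> and an edge set \<open>E\<close> consisting of
  two-element subsets of \<open>V\<close>. A rectilinear drawing is determined by the placement
  \<open>p\<close> of the vertices; only the values of \<open>p\<close> on \<open>V\<close> matter.
\<close>

type_synonym plane = "real \<times> real"

definition complete_edges :: "nat \<Rightarrow> nat set set" where
  "complete_edges n = nsets {..<n} 2"

text \<open>
  The relative interior of the segment representing the edge \<open>e = {u, v}\<close>; the two orderings
  of the endpoints give the same open segment.
\<close>

definition edge_interior :: "('a \<Rightarrow> plane) \<Rightarrow> 'a set \<Rightarrow> plane set" where
  "edge_interior p e = \<Union> {open_segment (p u) (p v) | u v. e = {u, v}}"

definition rectilinear_drawing :: "'a set \<Rightarrow> 'a set set \<Rightarrow> ('a \<Rightarrow> plane) \<Rightarrow> bool" where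
  "rectilinear_drawing V E p \<longleftrightarrow>
     inj_on p V \<and>
     (\<forall>u\<in>V. \<forall>v\<in>V. \<forall>w\<in>V. u \<noteq> v \<and> u \<noteq> w \<and> v \<noteq> w \<longrightarrow> \<not> collinear {p u, p v, p w}) \<and>
     (\<forall>e\<in>E. \<forall>f\<in>E. \<forall>g\<in>E. e \<noteq> f \<and> e \<noteq> g \<and> f \<noteq> g \<longrightarrow>
        edge_interior p e \<inter> edge_interior p f \<inter> edge_interior p g = {})"

definition crossings :: "'a set set \<Rightarrow> ('a \<Rightarrow> plane) \<Rightarrow> plane set" where
  "crossings E p =
     {x. \<exists>e\<in>E. \<exists>f\<in>E. e \<noteq> f \<and> x \<in> edge_interior p e \<and> x \<in> edge_interior p f}"

text \<open>
  In a rectilinear drawing every edge contains only finitely many crossings, and each of them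
  lies on exactly one other edge, so counting points is the same as counting crossing edges.
\<close>

definition num_crossings :: "'a set set \<Rightarrow> ('a \<Rightarrow> plane) \<Rightarrow> 'a set \<Rightarrow> nat" where
  "num_crossings E p e = card (crossings E p \<inter> edge_interior p e)"

definition e_count :: "nat \<Rightarrow> 'a set set \<Rightarrow> ('a \<Rightarrow> plane) \<Rightarrow> nat" where
  "e_count k E p = card {e \<in> E. num_crossings E p e = k}"

text \<open>
  The least value attained; it is meaningful only if the graph has a rectilinear drawing.
\<close>

definition min_e :: "nat \<Rightarrow> 'a set \<Rightarrow> 'a set set \<Rightarrow> nat" where
  "min_e k V E = (LEAST m. \<exists>p. rectilinear_drawing V E p \<and> e_count k E p = m)"

end

theory Submission
  imports Defs
begin

text \<open>
  Given a set \<open>K\<close> of kinks, place the vertices on the graph of a function that has a large convex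
  kink at each element of \<open>K\<close> and is slightly concave in between, and move them vertically so that
  no three edges are concurrent. Three vertices \<open>x < y < z\<close> make a right turn exactly if no kink
  lies strictly between \<open>x\<close> and \<open>z\<close>. An edge \<open>xy\<close> with a kink strictly inside has
  \<open>b (n - 2 - b) - c x - c y\<close> crossings, where \<open>b = y - x - 1\<close> and \<open>c z\<close> counts the kink-free
  intervals around \<open>z\<close>; so \<open>c z\<close> vanishes at kinks and at \<open>0\<close>, \<open>n - 1\<close> only. The remaining
  edges have few crossings.

  If \<open>k\<close> is not of the form \<open>a (n - 2 - a)\<close>, convex position works. Otherwise let \<open>2 a \<le> n - 2\<close>.
  If \<open>a\<close> is not close to half of \<open>n - 2\<close>, consecutive values of \<open>b (n - 2 - b)\<close> near \<open>k\<close> are far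
  apart, and closely spaced kinks, no two of which differ by \<open>a + 1\<close> or \<open>n - (a + 1)\<close>, lower the
  crossing number of every critical edge by a small positive amount. If \<open>a\<close> is close to half of \<open>n - 2\<close>,
  two kinks at \<open>n/3\<close> and \<open>2n/3\<close> lower the crossing numbers of all long edges far below \<open>k\<close>.
\<close>

section \<open>Point sets with distinct abscissas\<close>

definition pt :: "(nat \<Rightarrow> real) \<Rightarrow> nat \<Rightarrow> plane" where
  "pt h x = (real x, h x)"

definition chord :: "(nat \<Rightarrow> real) \<Rightarrow> nat \<Rightarrow> nat \<Rightarrow> real \<Rightarrow> real" where
  "chord h x y t = h x + (h y - h x) / (real y - real x) * (t - real x)"

text \<open>Twice the signed area of the triangle on the three points: for \<open>x < y < z\<close>
  it is negative exactly if the middle point lies above the line through the outer two.\<close>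

definition turn :: "(nat \<Rightarrow> real) \<Rightarrow> nat \<Rightarrow> nat \<Rightarrow> nat \<Rightarrow> real" where
  "turn h x y z = (real y - real x) * (h z - h x) - (real z - real x) * (h y - h x)"

definition generic :: "(nat \<Rightarrow> real) \<Rightarrow> nat \<Rightarrow> bool" where
  "generic h n \<longleftrightarrow> (\<forall>x y z. x < y \<longrightarrow> y < z \<longrightarrow> z < n \<longrightarrow> turn h x y z \<noteq> 0)"

lemma chord_left [simp]: "chord h x y (real x) = h x"
  by (simp add: chord_def)

lemma chord_right [simp]: "x \<noteq> y \<Longrightarrow> chord h x y (real y) = h y"
  by (simp add: chord_def)

lemma chord_turn: "x \<noteq> y \<Longrightarrow> (chord h x y (real u) - h u) * (real y - real x) = turn h x u y"
  by (simp add: chord_def turn_def field_simps)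

lemma chord_turn_less:
  assumes "x < y"
  shows "chord h x y (real u) < h u \<longleftrightarrow> turn h x u y < 0"
  using chord_turn[of x y h u] assms
  by (smt (verit) mult_less_0_iff of_nat_less_iff zero_less_mult_iff)

text \<open>\<open>generic\<close> covers increasing triples only, but permuting the points changes
  \<open>turn\<close> at most by its sign, so a vanishing \<open>turn\<close> carries over to the
  sorted triple.\<close>

lemma generic_chord:
  assumes "generic h n" "x < n" "y < n" "u < n" "x \<noteq> y" "u \<noteq> x" "u \<noteq> y"
  shows "chord h x y (real u) \<noteq> h u"
proof
  assume "chord h x y (real u) = h u"
  with chord_turn[of x y h u] assms(5) have t: "turn h x u y = 0" by simp
  then have t0: "turn h u x y = 0" "turn h x y u = 0" "turn h y x u = 0" "turn h u y x = 0" "turn h y u x = 0"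
    by (simp_all add: turn_def algebra_simps)
  have nz: "turn h a b c \<noteq> 0" if "a < b" "b < c" "c < n" for a b c
    using assms(1) that by (simp add: generic_def)
  consider "x < y" "y < u" | "x < u" "u < y" | "u < x" "x < y"
    | "y < x" "x < u" | "y < u" "u < x" | "u < y" "y < x"
    using assms(5-7) by linarith
  then show False using nz t t0 assms(2-4) by cases blast+
qed

lemma edge_interior_pair:
  "edge_interior p {u, v} = open_segment (p u) (p v)"
  by (auto simp: edge_interior_def doubleton_eq_iff open_segment_commute)

lemma edge_interior_pt:
  assumes "x < y"
  shows "edge_interior (pt h) {x, y} = {(t, chord h x y t) | t. real x < t \<and> t < real y}"
proof -
  let ?d = "real y - real x"
  have d: "?d > 0" using assms by simp
  have "open_segment (pt h x) (pt h y) = {(t, chord h x y t) | t. real x < t \<and> t < real y}"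
  proof (rule set_eqI)
    fix z :: plane
    have "z \<in> open_segment (pt h x) (pt h y) \<longleftrightarrow>
      (\<exists>u. 0 < u \<and> u < 1 \<and> z = (real x + u * ?d, h x + u * (h y - h x)))"
      using assms by (auto simp: in_segment pt_def algebra_simps)
    also have "\<dots> \<longleftrightarrow> (\<exists>t. real x < t \<and> t < real y \<and> z = (t, chord h x y t))"
    proof
      assume "\<exists>u. 0 < u \<and> u < 1 \<and> z = (real x + u * ?d, h x + u * (h y - h x))"
      then obtain u where u: "0 < u" "u < 1" "z = (real x + u * ?d, h x + u * (h y - h x))"
        by blast
      have "u * ?d < 1 * ?d" using u d by (intro mult_strict_right_mono) auto
      then have "real x + u * ?d < real x + ?d" by simp
      then have "real x + u * ?d < real y" by simp
      then show "\<exists>t. real x < t \<and> t < real y \<and> z = (t, chord h x y t)"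
        using u d by (intro exI[of _ "real x + u * ?d"]) (auto simp: chord_def)
    next
      assume "\<exists>t. real x < t \<and> t < real y \<and> z = (t, chord h x y t)"
      then obtain t where "real x < t" "t < real y" "z = (t, chord h x y t)" by blast
      then show "\<exists>u. 0 < u \<and> u < 1 \<and> z = (real x + u * ?d, h x + u * (h y - h x))"
        using d by (intro exI[of _ "(t - real x) / ?d"]) (auto simp: chord_def)
    qed
    finally show "z \<in> open_segment (pt h x) (pt h y) \<longleftrightarrow>
       z \<in> {(t, chord h x y t) | t. real x < t \<and> t < real y}" by auto
  qed
  then show ?thesis by (simp add: edge_interior_pair)
qed

section \<open>Crossings of two edges as zeros of an affine function\<close>

definition affine_fun :: "(real \<Rightarrow> real) \<Rightarrow> bool" where
  "affine_fun g \<longleftrightarrow> (\<exists>\<alpha> \<beta>. \<forall>t. g t = \<alpha> + \<beta> * t)"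

lemma affine_fun_chord_diff: "affine_fun (\<lambda>t. chord h x y t - chord h u v t)"
proof -
  have "b + s * (t - a) - (b' + s' * (t - a')) = (b - s * a - b' + s' * a') + (s - s') * t"
    for a a' b b' s s' t :: real by (simp add: algebra_simps)
  then show ?thesis unfolding affine_fun_def chord_def by blast
qed

lemma affine_fun_uminus: "affine_fun g \<Longrightarrow> affine_fun (\<lambda>t. - g t)"
  unfolding affine_fun_def by (metis add.inverse_distrib_swap add.commute mult_minus_left)

lemma affine_fun_pos:
  assumes "affine_fun g" "a \<le> t" "t \<le> b" "g a > 0" "g b > 0"
  shows "g t > 0"
proof -
  obtain \<alpha> \<beta> where g: "\<And>t. g t = \<alpha> + \<beta> * t" using assms(1) by (auto simp: affine_fun_def)
  show ?thesis
  proof (cases "\<beta> \<ge> 0")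
    case True
    then have "\<beta> * a \<le> \<beta> * t" using assms(2) by (rule mult_left_mono[rotated])
    then show ?thesis using assms(4) g by simp
  next
    case False
    then have "\<beta> * b \<le> \<beta> * t" using assms(3) by (simp add: mult_left_mono_neg)
    then show ?thesis using assms(5) g by simp
  qed
qed

lemma affine_fun_zero:
  assumes "affine_fun g" "a < b" "g a > 0 \<longleftrightarrow> g b < 0" "g a \<noteq> 0" "g b \<noteq> 0"
  obtains t where "a < t" "t < b" "g t = 0"
proof -
  obtain \<alpha> \<beta> where g: "\<And>t. g t = \<alpha> + \<beta> * t" using assms(1) by (auto simp: affine_fun_def)
  have cont: "continuous_on {a..b} g"
    unfolding g[abs_def] by (intro continuous_intros)
  have "\<exists>t\<ge>a. t \<le> b \<and> g t = 0"
  proof (cases "g a > 0")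
    case True
    then show ?thesis using assms by (intro IVT2') (auto simp: cont)
  next
    case False
    then show ?thesis using assms by (intro IVT') (auto simp: cont)
  qed
  then show ?thesis using that assms(4,5) by (metis order_le_less)
qed

lemma affine_fun_unique:
  assumes "affine_fun g" "g a = 0" "g b = 0" "a \<noteq> b"
  shows "g t = 0"
proof -
  obtain \<alpha> \<beta> where g: "\<And>t. g t = \<alpha> + \<beta> * t" using assms(1) by (auto simp: affine_fun_def)
  have "\<beta> * (a - b) = g a - g b" by (simp add: g algebra_simps)
  then have "\<beta> = 0" using assms(2-4) by simp
  then show ?thesis using g[of t] g[of a] assms(2) by simp
qed

lemma edges_meet_iff:
  assumes "x < y" "u < v"
  shows "edge_interior (pt h) {x, y} \<inter> edge_interior (pt h) {u, v} \<noteq> {} \<longleftrightarrow>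
    (\<exists>t. max (real x) (real u) < t \<and> t < min (real y) (real v) \<and> chord h x y t - chord h u v t = 0)"
  unfolding edge_interior_pt[OF assms(1)] edge_interior_pt[OF assms(2)] by auto

text \<open>Two common points force the difference of the chords to vanish identically; then
  \<open>u\<close> and \<open>v\<close> lie on the line through \<open>x\<close> and
  \<open>y\<close>, and genericity leaves only \<open>{u, v} = {x, y}\<close>.\<close>

lemma edges_meet_unique:
  assumes "generic h n" "x < y" "y < n" "u < v" "v < n" "{x, y} \<noteq> {u, v}"
    and "P \<in> edge_interior (pt h) {x, y} \<inter> edge_interior (pt h) {u, v}"
    and "Q \<in> edge_interior (pt h) {x, y} \<inter> edge_interior (pt h) {u, v}"
  shows "P = Q"
proof (rule ccontr)
  assume "P \<noteq> Q"
  let ?g = "\<lambda>t. chord h x y t - chord h u v t"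
  obtain s t where s: "P = (s, chord h x y s)" "?g s = 0" and t: "Q = (t, chord h x y t)" "?g t = 0"
    using assms(7,8) unfolding edge_interior_pt[OF assms(2)] edge_interior_pt[OF assms(4)] by auto
  have st: "s \<noteq> t" using s t \<open>P \<noteq> Q\<close> by auto
  have z: "?g r = 0" for r
    using affine_fun_unique[OF affine_fun_chord_diff s(2) t(2) st] .
  have "chord h x y (real u) = h u" "chord h x y (real v) = h v"
    using z[of u] z[of v] assms(4) by auto
  then have "u \<in> {x, y}" "v \<in> {x, y}"
    using generic_chord[OF assms(1), of x y u] generic_chord[OF assms(1), of x y v] assms(2-5) by auto
  then show False using assms(2,4,6) by auto
qed

text \<open>The shared end is a zero of the difference of the chords outside the open overlap. A
  further zero would make the lines coincide and put \<open>c\<close> on the line through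
  \<open>a\<close> and \<open>b\<close>.\<close>

lemma edges_meet_shared:
  assumes "generic h n" "a < n" "b < n" "c < n" "a \<noteq> b" "a \<noteq> c" "b \<noteq> c"
  shows "edge_interior (pt h) {a, b} \<inter> edge_interior (pt h) {a, c} = {}"
proof (rule ccontr)
  assume ne: "\<not> ?thesis"
  obtain x y where xy: "{a, b} = {x, y}" "x < y"
    using assms(5) by (metis insert_commute linorder_neqE_nat)
  obtain u v where uv: "{a, c} = {u, v}" "u < v"
    using assms(6) by (metis insert_commute linorder_neqE_nat)
  let ?g = "\<lambda>t. chord h x y t - chord h u v t"
  obtain t where t: "max (real x) (real u) < t" "t < min (real y) (real v)" "?g t = 0"
    using ne unfolding xy uv edges_meet_iff[OF xy(2) uv(2)] by auto
  have "a = x \<or> a = y" "a = u \<or> a = v" using xy(1) uv(1) by auto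
  then have a: "?g (real a) = 0" "real a \<noteq> t" using xy(2) uv(2) t by auto
  have "?g (real c) = 0"
    using affine_fun_unique[OF affine_fun_chord_diff a(1) t(3) a(2)] .
  moreover have "chord h u v (real c) = h c" using uv by (auto simp: doubleton_eq_iff)
  ultimately have "chord h x y (real c) = h c" by simp
  moreover have "x < n" "y < n" "c \<noteq> x" "c \<noteq> y" using xy assms by (auto simp: doubleton_eq_iff)
  ultimately show False using generic_chord[OF assms(1), of x y c] xy assms(4) by auto
qed

text \<open>Over the common range from \<open>u\<close> to \<open>y\<close> the edges meet exactly
  if the difference of the chords changes sign. Its sign at \<open>u\<close> is that of
  \<open>turn h x u y\<close>; at \<open>y\<close> it is opposite to that of
  \<open>turn h u y v\<close>.\<close>

lemma edges_meet_interleaved: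
  assumes "generic h n" "x < u" "u < y" "y < v" "v < n"
  shows "edge_interior (pt h) {x, y} \<inter> edge_interior (pt h) {u, v} \<noteq> {} \<longleftrightarrow>
    (turn h x u y < 0 \<longleftrightarrow> turn h u y v < 0)"
proof -
  let ?g = "\<lambda>t. chord h x y t - chord h u v t"
  have xy: "x < y" and uv: "u < v" using assms by auto
  have n1: "turn h x u y \<noteq> 0" "turn h u y v \<noteq> 0" using assms by (auto simp: generic_def)
  have gu: "?g (real u) < 0 \<longleftrightarrow> turn h x u y < 0" "?g (real u) \<noteq> 0"
    using chord_turn_less[OF xy, of h u] chord_turn[of x y h u] n1 xy uv by auto
  have gy: "?g (real y) > 0 \<longleftrightarrow> turn h u y v < 0" "?g (real y) \<noteq> 0"
    using chord_turn_less[OF uv, of h y] chord_turn[of u v h y] n1 xy uv by auto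
  have range: "max (real x) (real u) = real u" "min (real y) (real v) = real y" using assms by auto
  show ?thesis unfolding edges_meet_iff[OF xy uv] range
  proof
    assume "\<exists>t. real u < t \<and> t < real y \<and> ?g t = 0"
    then obtain t where t: "real u < t" "t < real y" "?g t = 0" by blast
    show "turn h x u y < 0 \<longleftrightarrow> turn h u y v < 0"
    proof (rule ccontr)
      assume c: "\<not> ?thesis"
      then consider "?g (real u) > 0" "?g (real y) > 0" | "- ?g (real u) > 0" "- ?g (real y) > 0"
        using gu gy by linarith
      then show False
      proof cases
        case 1
        with affine_fun_pos[OF affine_fun_chord_diff, of "real u" t "real y" h x y u v] t show False by auto
      next
        case 2
        with affine_fun_pos[OF affine_fun_uminus[OF affine_fun_chord_diff], of "real u" t "real y" h x y u v] t
        show False by auto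
      qed
    qed
  next
    assume "turn h x u y < 0 \<longleftrightarrow> turn h u y v < 0"
    then have "?g (real u) > 0 \<longleftrightarrow> ?g (real y) < 0" using gu gy by linarith
    from affine_fun_zero[OF affine_fun_chord_diff _ this gu(2) gy(2)] assms(3)
    show "\<exists>t. real u < t \<and> t < real y \<and> ?g t = 0" by (metis of_nat_less_iff)
  qed
qed

text \<open>Both ends of the inner edge lie on the same side of the outer one, so the affine
  difference has no zero between them.\<close>

lemma edges_meet_nested:
  assumes "generic h n" "x < u" "u < v" "v < y" "y < n"
    and "turn h x u y < 0 \<longleftrightarrow> turn h x v y < 0"
  shows "edge_interior (pt h) {x, y} \<inter> edge_interior (pt h) {u, v} = {}"
proof (rule ccontr)
  assume ne: "\<not> ?thesis"
  let ?g = "\<lambda>t. chord h x y t - chord h u v t"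
  have xy: "x < y" using assms by auto
  have n1: "turn h x u y \<noteq> 0" "turn h x v y \<noteq> 0" using assms by (auto simp: generic_def)
  have gu: "?g (real u) < 0 \<longleftrightarrow> turn h x u y < 0" "?g (real u) \<noteq> 0"
    using chord_turn_less[OF xy, of h u] chord_turn[of x y h u] n1 xy assms(3) by auto
  have gv: "?g (real v) < 0 \<longleftrightarrow> turn h x v y < 0" "?g (real v) \<noteq> 0"
    using chord_turn_less[OF xy, of h v] chord_turn[of x y h v] n1 xy assms(3) by auto
  obtain t where t: "real u < t" "t < real v" "?g t = 0"
    using ne edges_meet_iff[OF xy assms(3)] by auto
  consider "?g (real u) > 0" "?g (real v) > 0" | "- ?g (real u) > 0" "- ?g (real v) > 0"
    using gu gv assms(6) by linarith
  then show False
  proof cases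
    case 1
    with affine_fun_pos[OF affine_fun_chord_diff, of "real u" t "real v" h x y u v] t show False by auto
  next
    case 2
    with affine_fun_pos[OF affine_fun_uminus[OF affine_fun_chord_diff], of "real u" t "real v" h x y u v] t
    show False by auto
  qed
qed

lemma edges_meet_disjoint:
  assumes "x < y" "y \<le> u" "u < v"
  shows "edge_interior (pt h) {x, y} \<inter> edge_interior (pt h) {u, v} = {}"
  unfolding edge_interior_pt[OF assms(1)] edge_interior_pt[OF assms(3)] using assms(2) by auto

lemma complete_edges_iff:
  "e \<in> complete_edges n \<longleftrightarrow> (\<exists>x y. x < y \<and> y < n \<and> e = {x, y})"
proof
  assume "e \<in> complete_edges n"
  then obtain a b where "e = {a, b}" "a \<noteq> b" "a < n" "b < n"
    unfolding complete_edges_def nsets_def by (auto simp: card_2_iff)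
  then show "\<exists>x y. x < y \<and> y < n \<and> e = {x, y}" by (metis insert_commute linorder_neqE_nat)
qed (auto simp: complete_edges_def nsets_def)

lemma complete_edgesE:
  assumes "e \<in> complete_edges n"
  obtains x y where "x < y" "y < n" "e = {x, y}"
  using assms complete_edges_iff by metis

lemma complete_edgesI: "x < y \<Longrightarrow> y < n \<Longrightarrow> {x, y} \<in> complete_edges n"
  using complete_edges_iff by metis

lemma complete_edges_mono: "m \<le> n \<Longrightarrow> complete_edges m \<subseteq> complete_edges n"
  unfolding complete_edges_def by (intro nsets_mono) auto

lemma finite_complete_edges: "finite (complete_edges n)"
  unfolding complete_edges_def by (simp add: finite_imp_finite_nsets)

section \<open>Removing concurrent edges\<close>

definition no_triple :: "(nat \<Rightarrow> real) \<Rightarrow> nat \<Rightarrow> bool" where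
  "no_triple h n \<longleftrightarrow> (\<forall>e\<in>complete_edges n. \<forall>f\<in>complete_edges n. \<forall>g\<in>complete_edges n.
     e \<noteq> f \<and> e \<noteq> g \<and> f \<noteq> g \<longrightarrow>
     edge_interior (pt h) e \<inter> edge_interior (pt h) f \<inter> edge_interior (pt h) g = {})"

lemma generic_drawing:
  assumes "generic h n" "no_triple h n"
  shows "rectilinear_drawing {..<n} (complete_edges n) (pt h)"
proof -
  have inj: "inj_on (pt h) {..<n}" by (auto simp: inj_on_def pt_def)
  have gp: "\<not> collinear {pt h u, pt h v, pt h w}"
    if "u < n" "v < n" "w < n" "u \<noteq> v" "u \<noteq> w" "v \<noteq> w" for u v w
  proof
    assume "collinear {pt h u, pt h v, pt h w}"
    then consider "pt h u = pt h w" | c where "pt h v = c *\<^sub>R pt h u + (1 - c) *\<^sub>R pt h w"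
      unfolding collinear_3_expand by blast
    then show False
    proof cases
      case 1
      then show False using that by (simp add: pt_def)
    next
      case 2
      then have c: "real v = c * real u + (1 - c) * real w" "h v = c * h u + (1 - c) * h w"
        by (auto simp: pt_def)
      have "turn h u v w = 0" unfolding turn_def c by (simp add: algebra_simps)
      with chord_turn[of u w h v] that have "chord h u w (real v) = h v" by auto
      then show False using generic_chord[OF assms(1), of u w v] that by auto
    qed
  qed
  show ?thesis
    unfolding rectilinear_drawing_def
  proof (intro conjI)
    show "\<forall>u\<in>{..<n}. \<forall>v\<in>{..<n}. \<forall>w\<in>{..<n}. u \<noteq> v \<and> u \<noteq> w \<and> v \<noteq> w \<longrightarrow>
        \<not> collinear {pt h u, pt h v, pt h w}"
      by (intro ballI impI gp) simp_all
  qed (rule inj, rule assms(2)[unfolded no_triple_def])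
qed

text \<open>Such a segment runs from the fixed end through \<open>P\<close>, so it reaches abscissa
  \<open>j\<close> at one determined height.\<close>

lemma finite_concurrent_heights:
  assumes "w \<noteq> j"
  shows "finite {c. P \<in> open_segment (real w, b) (real j, c :: real)}"
proof -
  have "c = b + (snd P - b) * (real j - real w) / (fst P - real w)"
    if "P \<in> open_segment (real w, b) (real j, c)" for c
  proof -
    from that have "\<exists>s. 0 < s \<and> s < 1 \<and> P = (1 - s) *\<^sub>R (real w, b) + s *\<^sub>R (real j, c)"
      unfolding in_segment by (rule conjunct2)
    then obtain s where s: "s > 0" "P = (1 - s) *\<^sub>R (real w, b) + s *\<^sub>R (real j, c)"
      by (elim exE conjE)
    have eq: "fst P - real w = s * (real j - real w)" "snd P - b = s * (c - b)"
      by (auto simp: s algebra_simps)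
    have "(snd P - b) * (real j - real w) / (fst P - real w) = c - b"
      unfolding eq using s(1) assms by simp
    then show ?thesis by simp
  qed
  then have "{c. P \<in> open_segment (real w, b) (real j, c)} \<subseteq>
    {b + (snd P - b) * (real j - real w) / (fst P - real w)}" by blast
  then show ?thesis using finite_subset by blast
qed

lemma edge_interior_upd:
  assumes "e \<in> complete_edges j"
  shows "edge_interior (pt (h(j := c))) e = edge_interior (pt h) e"
proof -
  obtain x y where "x < y" "y < j" "e = {x, y}" by (rule complete_edgesE[OF assms])
  then show ?thesis by (simp add: edge_interior_pair pt_def)
qed

lemma finite_edge_meet:
  assumes "generic h n" "f \<in> complete_edges n" "g \<in> complete_edges n" "f \<noteq> g"
  shows "finite (edge_interior (pt h) f \<inter> edge_interior (pt h) g)"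
proof (cases "edge_interior (pt h) f \<inter> edge_interior (pt h) g = {}")
  case False
  then obtain P where P: "P \<in> edge_interior (pt h) f \<inter> edge_interior (pt h) g" by blast
  obtain x y u v where "x < y" "y < n" "f = {x, y}" "u < v" "v < n" "g = {u, v}"
    using assms(2,3) complete_edges_iff by meson
  then have "edge_interior (pt h) f \<inter> edge_interior (pt h) g \<subseteq> {P}"
    using edges_meet_unique[OF assms(1), of x y u v _ P] P assms(4) by blast
  then show ?thesis using finite_subset by blast
qed auto

text \<open>Only triples with an edge ending at \<open>j\<close> are new. Two edges ending at
  \<open>j\<close> share that end and cannot meet; a single edge from \<open>w\<close> to
  \<open>j\<close> must avoid the finitely many crossings of old edges, which excludes finitely many
  heights \<open>c\<close>.\<close>

lemma no_triple_extend:
  assumes "generic h n" "no_triple h j" "j < n" "\<epsilon> > 0"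
    and gen: "\<And>c. \<bar>c - b\<bar> < \<epsilon> \<Longrightarrow> generic (h(j := c)) n"
  obtains c where "\<bar>c - b\<bar> < \<epsilon>" "no_triple (h(j := c)) (Suc j)"
proof -
  let ?E = "complete_edges j"
  let ?M = "\<lambda>f g. edge_interior (pt h) f \<inter> edge_interior (pt h) g"
  define B where "B = (\<Union>w\<in>{..<j}. \<Union>f\<in>?E. \<Union>g\<in>?E - {f}. \<Union>P\<in>?M f g.
     {c. P \<in> open_segment (real w, h w) (real j, c)})"
  have sub: "?E \<subseteq> complete_edges n" using assms(3) by (simp add: complete_edges_mono)
  have "finite (?M f g)" if "f \<in> ?E" "g \<in> ?E - {f}" for f g
    using finite_edge_meet[OF assms(1), of f g] that sub by blast
  moreover have "finite {c. P \<in> open_segment (real w, h w) (real j, c)}" if "w \<in> {..<j}" for w P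
    using finite_concurrent_heights[of w j P "h w"] that by simp
  ultimately have "finite B"
    unfolding B_def by (intro finite_UN_I finite_Diff finite_complete_edges finite_lessThan)
  moreover have "infinite {b - \<epsilon> <..< b + \<epsilon>}" using assms(4) by simp
  ultimately have "infinite ({b - \<epsilon> <..< b + \<epsilon>} - B)" by (rule Diff_infinite_finite)
  then have "{b - \<epsilon> <..< b + \<epsilon>} - B \<noteq> {}" by (metis finite.emptyI)
  then obtain c where c: "b - \<epsilon> < c" "c < b + \<epsilon>" "c \<notin> B" by (auto simp only: set_eq_iff Diff_iff greaterThanLessThan_iff empty_iff)
  let ?h = "h(j := c)"
  have cb: "\<bar>c - b\<bar> < \<epsilon>" using c(1,2) by linarith
  have new: "\<exists>w<j. e = {w, j}" if mem: "e \<in> complete_edges (Suc j)" "e \<notin> ?E" for e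
  proof -
    obtain x y where xy: "x < y" "y < Suc j" "e = {x, y}" by (rule complete_edgesE[OF mem(1)])
    moreover have "\<not> y < j" using xy mem(2) complete_edgesI by metis
    ultimately have "y = j" by simp
    then show ?thesis using xy by blast
  qed
  have one: "edge_interior (pt ?h) e \<inter> (edge_interior (pt ?h) f \<inter> edge_interior (pt ?h) g) = {}"
    if e: "e \<in> complete_edges (Suc j)" "e \<notin> ?E" and fg: "f \<in> ?E" "g \<in> ?E" "f \<noteq> g" for e f g
  proof -
    obtain w where w: "w < j" "e = {w, j}" using new[OF e] by blast
    then have "edge_interior (pt ?h) e = open_segment (real w, h w) (real j, c)"
      by (simp add: edge_interior_pair pt_def)
    moreover have "P \<notin> open_segment (real w, h w) (real j, c)" if "P \<in> ?M f g" for P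
    proof
      assume "P \<in> open_segment (real w, h w) (real j, c)"
      then have "c \<in> B" unfolding B_def using that w(1) fg
        by (intro UN_I[of w] UN_I[of f] UN_I[of g] UN_I[of P]) auto
      with c(3) show False ..
    qed
    ultimately show ?thesis unfolding edge_interior_upd[OF fg(1)] edge_interior_upd[OF fg(2)] by blast
  qed
  have two: "edge_interior (pt ?h) e \<inter> edge_interior (pt ?h) f = {}"
    if e: "e \<in> complete_edges (Suc j)" "e \<notin> ?E" and f: "f \<in> complete_edges (Suc j)" "f \<notin> ?E"
      and ef: "e \<noteq> f" for e f
  proof -
    obtain w where w: "w < j" "e = {w, j}" using new[OF e] by blast
    obtain v where v: "v < j" "f = {v, j}" using new[OF f] by blast
    show ?thesis
      using edges_meet_shared[OF gen[OF cb], of j w v] w v ef assms(3) by (auto simp: insert_commute)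
  qed
  let ?I = "edge_interior (pt ?h)" and ?S = "complete_edges (Suc j)"
  have three: "?I e \<inter> ?I f \<inter> ?I g = {}"
    if "e \<in> ?S" "f \<in> ?S" "g \<in> ?S" "e \<noteq> f" "e \<noteq> g" "f \<noteq> g" "e \<notin> ?E" for e f g
  proof -
    consider "f \<notin> ?E" | "g \<notin> ?E" | "f \<in> ?E" "g \<in> ?E" by blast
    then show ?thesis
    proof cases
      case 1
      have "?I e \<inter> ?I f = {}" by (rule two) fact+
      then show ?thesis by blast
    next
      case 2
      have "?I e \<inter> ?I g = {}" by (rule two) fact+
      then show ?thesis by blast
    next
      case 3
      have "?I e \<inter> (?I f \<inter> ?I g) = {}" by (rule one) fact+
      then show ?thesis by (simp only: Int_assoc)
    qed
  qed
  have "no_triple ?h (Suc j)" unfolding no_triple_def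
  proof (intro ballI impI)
    fix e f g assume S: "e \<in> ?S" "f \<in> ?S" "g \<in> ?S" and "e \<noteq> f \<and> e \<noteq> g \<and> f \<noteq> g"
    then have ne: "e \<noteq> f" "e \<noteq> g" "f \<noteq> g" by auto
    consider "e \<in> ?E" "f \<in> ?E" "g \<in> ?E" | "e \<notin> ?E" | "f \<notin> ?E" | "g \<notin> ?E" by blast
    then show "?I e \<inter> ?I f \<inter> ?I g = {}"
    proof cases
      case 1
      then show ?thesis using assms(2) ne by (simp add: no_triple_def edge_interior_upd)
    next
      case 2
      show ?thesis by (rule three) fact+
    next
      case 3
      have "?I f \<inter> ?I e \<inter> ?I g = {}" by (rule three[OF S(2,1,3) ne(1)[symmetric] ne(3,2) 3])
      then show ?thesis by (simp only: Int_commute)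
    next
      case 4
      have "?I g \<inter> ?I e \<inter> ?I f = {}"
        by (rule three[OF S(3,1,2) ne(2)[symmetric] ne(3)[symmetric] ne(1) 4])
      then show ?thesis by blast
    qed
  qed
  then show ?thesis using that cb by blast
qed

text \<open>Only heights are perturbed: a vertical move of a point meets each forbidden line at most once.\<close>

lemma perturb_no_triple:
  assumes "\<epsilon> > 0" and gen: "\<And>h. (\<And>x. \<bar>h x - h0 x\<bar> < \<epsilon>) \<Longrightarrow> generic h n"
  obtains h where "\<And>x. \<bar>h x - h0 x\<bar> < \<epsilon>" "no_triple h n"
proof -
  have "j \<le> n \<Longrightarrow> \<exists>h. (\<forall>x. \<bar>h x - h0 x\<bar> < \<epsilon>) \<and> no_triple h j" for j
  proof (induction j)
    case 0
    have "no_triple h0 0" by (auto simp: no_triple_def complete_edges_iff)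
    then show ?case using assms(1) by (intro exI[of _ h0]) auto
  next
    case (Suc j)
    then obtain h where h: "\<And>x. \<bar>h x - h0 x\<bar> < \<epsilon>" "no_triple h j" by auto
    obtain c where c: "\<bar>c - h0 j\<bar> < \<epsilon>" "no_triple (h(j := c)) (Suc j)"
    proof (rule no_triple_extend[OF gen[OF h(1)] h(2)])
      show "j < n" "\<epsilon> > 0" using Suc.prems assms(1) by auto
      show "generic (h(j := c)) n" if "\<bar>c - h0 j\<bar> < \<epsilon>" for c
        using that h(1) by (intro gen) auto
    qed
    moreover from c(1) h(1) have "\<bar>(h(j := c)) x - h0 x\<bar> < \<epsilon>" for x by simp
    ultimately show ?case by blast
  qed
  then show ?thesis using that by blast
qed

section \<open>Drawings with prescribed kinks\<close>

text \<open>The turn depends on the outer points only: all vertices strictly between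
  \<open>x\<close> and \<open>z\<close> lie above the edge \<open>xz\<close> if it is kink-free, and
  below it otherwise.\<close>

definition kink_pattern :: "nat set \<Rightarrow> (nat \<Rightarrow> real) \<Rightarrow> nat \<Rightarrow> bool" where
  "kink_pattern K h n \<longleftrightarrow> (\<forall>x y z. x < y \<longrightarrow> y < z \<longrightarrow> z < n \<longrightarrow>
     turn h x y z \<noteq> 0 \<and> (turn h x y z < 0 \<longleftrightarrow> K \<inter> {x<..<z} = {}))"

lemma kink_pattern_generic: "kink_pattern K h n \<Longrightarrow> generic h n"
  by (auto simp: kink_pattern_def generic_def)

text \<open>
  Truncated subtraction makes \<open>\<lambda>x. x - t\<close> the convex function with a single kink at \<open>t\<close>.
\<close>

lemma turn_single_kink:
  fixes x y z t :: nat
  assumes "x < y" "y < z"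
  defines "D \<equiv> (int y - int x) * (int (z - t) - int (x - t)) - (int z - int x) * (int (y - t) - int (x - t))"
  shows "t \<in> {x<..<z} \<Longrightarrow> D \<ge> 1" "t \<notin> {x<..<z} \<Longrightarrow> D = 0"
proof -
  assume t: "t \<in> {x<..<z}"
  show "D \<ge> 1"
  proof (cases "t \<le> y")
    case True
    then have "D = (int z - int y) * (int t - int x)"
      unfolding D_def using t assms by (simp add: of_nat_diff algebra_simps)
    moreover have "\<dots> > 0" using t assms by simp
    ultimately show ?thesis by linarith
  next
    case False
    then have "D = (int y - int x) * (int z - int t)"
      unfolding D_def using t assms by (simp add: of_nat_diff)
    moreover have "\<dots> > 0" using t assms by simp
    ultimately show ?thesis by linarith
  qed
next
  assume "t \<notin> {x<..<z}"
  then consider "t \<le> x" | "z \<le> t" by fastforce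
  then show "D = 0"
    unfolding D_def using assms by cases (simp_all add: of_nat_diff algebra_simps)
qed

text \<open>The heights are \<open>M\<close> times a sum of single-kink functions minus a square.
  The square contributes \<open>- Q x y z\<close>, between \<open>- n ^ 3\<close> and
  \<open>- 1\<close>, and each kink strictly inside contributes at least
  \<open>M = n ^ 3 + 1\<close>. Integrality leaves room for a later perturbation.\<close>

lemma integral_kink_heights:
  obtains H :: "nat \<Rightarrow> int" where
    "\<And>x y z. x < y \<Longrightarrow> y < z \<Longrightarrow> z < n \<Longrightarrow> K \<inter> {x<..<z} = {} \<Longrightarrow>
       (int y - int x) * (H z - H x) - (int z - int x) * (H y - H x) \<le> -1"
    "\<And>x y z. x < y \<Longrightarrow> y < z \<Longrightarrow> z < n \<Longrightarrow> K \<inter> {x<..<z} \<noteq> {} \<Longrightarrow>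
       (int y - int x) * (H z - H x) - (int z - int x) * (H y - H x) \<ge> 1"
proof -
  define S where "S = K \<inter> {..<n}"
  define F :: "nat \<Rightarrow> int" where "F x = (\<Sum>t\<in>S. int (x - t))" for x
  define M :: int where "M = int n ^ 3 + 1"
  define H where "H x = M * F x - int x ^ 2" for x
  define D where "D x y z t = (int y - int x) * (int (z - t) - int (x - t)) - (int z - int x) * (int (y - t) - int (x - t))"
    for x y z t
  define Q where "Q x y z = (int y - int x) * (int z - int x) * (int z - int y)" for x y z
  have fin: "finite S" by (simp add: S_def)
  have FD: "(int y - int x) * (F z - F x) - (int z - int x) * (F y - F x) = (\<Sum>t\<in>S. D x y z t)" for x y z
    by (simp add: F_def D_def sum_distrib_left sum_subtractf right_diff_distrib)
  have HD: "(int y - int x) * (H z - H x) - (int z - int x) * (H y - H x)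
      = M * (\<Sum>t\<in>S. D x y z t) - Q x y z" for x y z
    unfolding FD[symmetric] by (simp add: H_def Q_def power2_eq_square algebra_simps)
  have Qpos: "Q x y z \<ge> 1" if "x < y" "y < z" for x y z
  proof -
    have "Q x y z > 0" using that by (simp add: Q_def)
    then show ?thesis by linarith
  qed
  have Qle: "Q x y z \<le> int n ^ 3" if "x < y" "y < z" "z < n" for x y z
  proof -
    have "Q x y z \<le> int n * int n * int n"
      unfolding Q_def using that by (intro mult_mono) auto
    then show ?thesis by (simp add: power3_eq_cube)
  qed
  show ?thesis
  proof (rule that[of H])
    fix x y z :: nat assume xyz: "x < y" "y < z" "z < n"
    {
      assume "K \<inter> {x<..<z} = {}"
      then have "D x y z t = 0" if "t \<in> S" for t
      proof -
        have "t \<notin> {x<..<z}" using that \<open>K \<inter> {x<..<z} = {}\<close> by (auto simp: S_def)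
        then show ?thesis unfolding D_def by (rule turn_single_kink(2)[OF xyz(1,2)])
      qed
      then have "(\<Sum>t\<in>S. D x y z t) = 0" by simp
      then show "(int y - int x) * (H z - H x) - (int z - int x) * (H y - H x) \<le> -1"
        unfolding HD using Qpos[OF xyz(1,2)] by simp
    next
      assume "K \<inter> {x<..<z} \<noteq> {}"
      then obtain t where t: "t \<in> K" "t \<in> {x<..<z}" by blast
      have nonneg: "D x y z s \<ge> 0" for s
        using turn_single_kink[OF xyz(1,2), of s] by (force simp: D_def)
      have "1 \<le> D x y z t" using turn_single_kink(1)[OF xyz(1,2) t(2)] by (simp add: D_def)
      also have "\<dots> \<le> (\<Sum>t\<in>S. D x y z t)"
        using t xyz nonneg fin by (intro member_le_sum) (auto simp: S_def)
      finally have "M * 1 \<le> M * (\<Sum>t\<in>S. D x y z t)"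
        by (intro mult_left_mono) (auto simp: M_def)
      then show "(int y - int x) * (H z - H x) - (int z - int x) * (H y - H x) \<ge> 1"
        unfolding HD using Qle[OF xyz] M_def by linarith
    }
  qed
qed

text \<open>Each difference of heights changes by less than \<open>2 / (4 * n)\<close> and is
  multiplied by a difference of abscissas below \<open>n\<close>, so each of the two products
  changes by at most one half, the second by strictly less.\<close>

lemma turn_perturb:
  assumes "x < y" "y < z" "z < n" "\<And>x. \<bar>h x - h0 x\<bar> < 1 / (4 * real n)"
  shows "\<bar>turn h x y z - turn h0 x y z\<bar> < 1"
proof -
  define g where "g x = h x - h0 x" for x
  let ?\<epsilon> = "1 / (4 * real n)"
  have g: "\<bar>g x\<bar> < ?\<epsilon>" for x using assms(4) by (simp add: g_def)
  have "\<bar>(real y - real x) * (g z - g x)\<bar> \<le> real n * (2 * ?\<epsilon>)"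
    unfolding abs_mult using assms g[of x] g[of z] by (intro mult_mono) auto
  moreover have "\<bar>(real z - real x) * (g y - g x)\<bar> < real n * (2 * ?\<epsilon>)"
    unfolding abs_mult using assms g[of x] g[of y] by (intro mult_strict_mono) auto
  moreover have "real n * (2 * ?\<epsilon>) = 1 / 2" using assms by simp
  moreover have "turn h x y z - turn h0 x y z = (real y - real x) * (g z - g x) - (real z - real x) * (g y - g x)"
    by (simp add: turn_def g_def algebra_simps)
  ultimately show ?thesis by linarith
qed

lemma kink_drawing_exists:
  obtains h where "kink_pattern K h n" "no_triple h n"
proof (cases "n = 0")
  case True
  then show ?thesis
    using that[of "\<lambda>_. 0"] complete_edgesE[of _ 0 False]
    by (auto simp: kink_pattern_def no_triple_def)
next
  case False
  obtain H :: "nat \<Rightarrow> int" where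
    H: "\<And>x y z. x < y \<Longrightarrow> y < z \<Longrightarrow> z < n \<Longrightarrow> K \<inter> {x<..<z} = {} \<Longrightarrow>
       (int y - int x) * (H z - H x) - (int z - int x) * (H y - H x) \<le> -1"
    "\<And>x y z. x < y \<Longrightarrow> y < z \<Longrightarrow> z < n \<Longrightarrow> K \<inter> {x<..<z} \<noteq> {} \<Longrightarrow>
       (int y - int x) * (H z - H x) - (int z - int x) * (H y - H x) \<ge> 1"
    using integral_kink_heights[of n K] by metis
  define h0 where "h0 x = real_of_int (H x)" for x
  have turn_h0: "turn h0 x y z = real_of_int ((int y - int x) * (H z - H x) - (int z - int x) * (H y - H x))" for x y z
    by (simp add: turn_def h0_def)
  \<comment> \<open>The turns of \<open>h0\<close> have absolute value at least 1 and move by less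
    than 1, so all signs survive.\<close>
  have pattern: "kink_pattern K h n" if h: "\<And>x. \<bar>h x - h0 x\<bar> < 1 / (4 * real n)" for h
    unfolding kink_pattern_def
  proof (intro allI impI)
    fix x y z assume xyz: "x < y" "y < z" "z < n"
    have near: "\<bar>turn h x y z - turn h0 x y z\<bar> < 1" using turn_perturb[OF xyz h] .
    show "turn h x y z \<noteq> 0 \<and> (turn h x y z < 0 \<longleftrightarrow> K \<inter> {x<..<z} = {})"
    proof (cases "K \<inter> {x<..<z} = {}")
      case True
      then have "turn h0 x y z \<le> -1" unfolding turn_h0 using H(1)[OF xyz] by linarith
      then show ?thesis using near True by auto
    next
      case False
      then have "turn h0 x y z \<ge> 1" unfolding turn_h0 using H(2)[OF xyz] by linarith
      then show ?thesis using near False by auto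
    qed
  qed
  have "1 / (4 * real n) > 0" using False by simp
  then obtain h where h: "\<And>x. \<bar>h x - h0 x\<bar> < 1 / (4 * real n)" "no_triple h n"
    using perturb_no_triple[OF _ kink_pattern_generic[OF pattern]] by metis
  show ?thesis by (rule that[OF pattern[OF h(1)] h(2)])
qed

section \<open>Crossings counted as pairs of vertices\<close>

definition crossers :: "nat set \<Rightarrow> nat \<Rightarrow> nat \<Rightarrow> nat \<Rightarrow> (nat \<times> nat) set" where
  "crossers K n x y = {(u, v). x < u \<and> u < y \<and> v < n \<and> (v < x \<or> y < v) \<and>
     (K \<inter> {min u v<..<max u v} = {} \<longleftrightarrow> K \<inter> {x<..<y} = {})}"

text \<open>Crossing points on \<open>e\<close> correspond to crossing edges: two edges meet in at
  most one point, and without concurrent triples different edges meet \<open>e\<close> in different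
  points.\<close>

lemma num_crossings_card_edges:
  assumes "generic h n" "no_triple h n" "e \<in> complete_edges n"
  shows "num_crossings (complete_edges n) (pt h) e =
    card {f \<in> complete_edges n. f \<noteq> e \<and> edge_interior (pt h) e \<inter> edge_interior (pt h) f \<noteq> {}}"
proof -
  let ?E = "complete_edges n" and ?I = "edge_interior (pt h)"
  let ?F = "{f \<in> ?E. f \<noteq> e \<and> ?I e \<inter> ?I f \<noteq> {}}"
  have uniq: "P = Q" if mem: "f \<in> ?F" "P \<in> ?I e \<inter> ?I f" "Q \<in> ?I e \<inter> ?I f" for f P Q
  proof -
    obtain x y where xy: "x < y" "y < n" "e = {x, y}" by (rule complete_edgesE[OF assms(3)])
    obtain u v where uv: "u < v" "v < n" "f = {u, v}"
      using mem(1) by (elim CollectE conjE complete_edgesE)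
    show ?thesis
      by (rule edges_meet_unique[OF assms(1) xy(1,2) uv(1,2)]) (use mem xy(3) uv(3) in auto)
  qed
  define \<phi> where "\<phi> f = (SOME P. P \<in> ?I e \<inter> ?I f)" for f
  have \<phi>: "\<phi> f \<in> ?I e \<inter> ?I f" if "f \<in> ?F" for f
    using that unfolding \<phi>_def by (metis (mono_tags, lifting) ex_in_conv mem_Collect_eq someI_ex)
  have nt: "f = g" if "f \<in> ?F" "g \<in> ?F" "P \<in> ?I e" "P \<in> ?I f" "P \<in> ?I g" for f g P
    using assms(2,3) that unfolding no_triple_def by blast
  have "bij_betw \<phi> ?F (crossings ?E (pt h) \<inter> ?I e)"
  proof (rule bij_betw_imageI)
    show "inj_on \<phi> ?F"
      using \<phi> nt by (metis (no_types, lifting) IntD1 IntD2 inj_onI)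
    show "\<phi> ` ?F = crossings ?E (pt h) \<inter> ?I e"
    proof (intro equalityI subsetI)
      fix P assume "P \<in> \<phi> ` ?F"
      then obtain f where "f \<in> ?F" "P = \<phi> f" by blast
      then show "P \<in> crossings ?E (pt h) \<inter> ?I e"
        using \<phi> assms(3) unfolding crossings_def by blast
    next
      fix P assume P: "P \<in> crossings ?E (pt h) \<inter> ?I e"
      then obtain a b where "a \<in> ?E" "b \<in> ?E" "a \<noteq> b" "P \<in> ?I a" "P \<in> ?I b" "P \<in> ?I e"
        unfolding crossings_def by blast
      \<comment> \<open>As \<open>a\<close> and \<open>b\<close> differ, at least one of them is not
        \<open>e\<close>.\<close>
      then have "\<exists>f\<in>?E. f \<noteq> e \<and> P \<in> ?I e \<inter> ?I f"
        by blast
      then obtain f where f: "f \<in> ?F" "P \<in> ?I e \<inter> ?I f" by blast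
      then have "\<phi> f = P" using uniq \<phi> by blast
      then show "P \<in> \<phi> ` ?F" using f by blast
    qed
  qed
  then show ?thesis unfolding num_crossings_def by (simp add: bij_betw_same_card)
qed

text \<open>Edges that share an end, are separated or are nested do not meet; nested ones because
  both inner ends are on the same side of the outer edge. Interleaved edges meet exactly if both
  have a kink strictly inside or neither has. Listing the end inside \<open>xy\<close> first makes
  each crossing edge a unique pair.\<close>

lemma card_crossing_edges:
  assumes "kink_pattern K h n" "x < y" "y < n"
  shows "card {f \<in> complete_edges n. f \<noteq> {x, y} \<and> edge_interior (pt h) {x, y} \<inter> edge_interior (pt h) f \<noteq> {}}
    = card (crossers K n x y)"
proof -
  let ?I = "edge_interior (pt h)"
  let ?F = "{f \<in> complete_edges n. f \<noteq> {x, y} \<and> ?I {x, y} \<inter> ?I f \<noteq> {}}"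
  have gen: "generic h n" using assms(1) by (rule kink_pattern_generic)
  have turn: "turn h a b c < 0 \<longleftrightarrow> K \<inter> {a<..<c} = {}" if "a < b" "b < c" "c < n" for a b c
    using assms(1) that by (simp add: kink_pattern_def)
  have shared: "?I {a, b} \<inter> ?I {a, c} = {}" if "a < n" "b < n" "c < n" "a \<noteq> b" "a \<noteq> c" "b \<noteq> c" for a b c
    using edges_meet_shared[OF gen that] .
  have nested: "?I {a, d} \<inter> ?I {b, c} = {}" if "a < b" "b < c" "c < d" "d < n" for a b c d
    using that by (intro edges_meet_nested[OF gen]) (auto simp: turn)
  have right: "?I {x, y} \<inter> ?I {a, b} \<noteq> {} \<longleftrightarrow> (K \<inter> {a<..<b} = {} \<longleftrightarrow> K \<inter> {x<..<y} = {})"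
    if "x < a" "a < y" "y < b" "b < n" for a b
    using edges_meet_interleaved[OF gen that] that by (auto simp: turn)
  have left: "?I {x, y} \<inter> ?I {a, b} \<noteq> {} \<longleftrightarrow> (K \<inter> {a<..<b} = {} \<longleftrightarrow> K \<inter> {x<..<y} = {})"
    if "a < x" "x < b" "b < y" for a b
    using edges_meet_interleaved[OF gen that assms(3)] that assms(3) by (auto simp: turn Int_commute)
  have "bij_betw (\<lambda>(u, v). {u, v}) (crossers K n x y) ?F"
  proof (rule bij_betw_imageI)
    show "inj_on (\<lambda>(u, v). {u, v}) (crossers K n x y)"
      by (auto simp: inj_on_def crossers_def doubleton_eq_iff)
    show "(\<lambda>(u, v). {u, v}) ` crossers K n x y = ?F"
    proof (intro equalityI subsetI)
      fix f assume "f \<in> (\<lambda>(u, v). {u, v}) ` crossers K n x y"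
      then obtain u v where f: "f = {u, v}" and u: "x < u" "u < y" and v: "v < n" "v < x \<or> y < v"
        and K: "K \<inter> {min u v<..<max u v} = {} \<longleftrightarrow> K \<inter> {x<..<y} = {}"
        by (auto simp: crossers_def)
      have "?I {x, y} \<inter> ?I f \<noteq> {}"
        using v(2)
      proof
        assume "v < x"
        then show ?thesis using left[of v u] u K f by (simp add: min_def max_def insert_commute)
      next
        assume "y < v"
        then show ?thesis using right[of u v] u v K f by (simp add: min_def max_def)
      qed
      moreover have "f \<noteq> {x, y}" using f u by (auto simp: doubleton_eq_iff)
      moreover have "f \<in> complete_edges n"
        using f u v assms by (auto simp: complete_edges_def nsets_def)
      ultimately show "f \<in> ?F" by blast
    next
      fix f assume F: "f \<in> ?F"
      then obtain a b where ab: "a < b" "b < n" "f = {a, b}" by (elim CollectE conjE complete_edgesE)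
      have meet: "?I {x, y} \<inter> ?I {a, b} \<noteq> {}" and ne: "{a, b} \<noteq> {x, y}" using F ab by auto
      have "a \<noteq> x" using shared[of x y b] ab assms meet ne by auto
      moreover have "a \<noteq> y" using edges_meet_disjoint[OF assms(2) _ ab(1)] meet by blast
      moreover have "b \<noteq> x" using edges_meet_disjoint[OF ab(1) _ assms(2)] meet by blast
      moreover have "b \<noteq> y" using shared[of y x a] ab assms meet ne by (auto simp: insert_commute)
      moreover have "a < y" using edges_meet_disjoint[OF assms(2) _ ab(1)] meet by (meson not_le)
      moreover have "x < b" using edges_meet_disjoint[OF ab(1) _ assms(2)] meet by (metis Int_commute not_le)
      moreover have "\<not> (a < x \<and> y < b)" using nested[of a x y b] assms ab meet by (auto simp: Int_commute)
      moreover have "\<not> (x < a \<and> b < y)" using nested[of x a b y] assms ab meet by auto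
      ultimately consider "x < a" "a < y" "y < b" | "a < x" "x < b" "b < y" by linarith
      then show "f \<in> (\<lambda>(u, v). {u, v}) ` crossers K n x y"
      proof cases
        case 1
        then have "(a, b) \<in> crossers K n x y" using right[of a b] meet ab by (auto simp: crossers_def)
        then have "(\<lambda>(u, v). {u, v}) (a, b) \<in> (\<lambda>(u, v). {u, v}) ` crossers K n x y" by (rule imageI)
        then show ?thesis using ab by simp
      next
        case 2
        then have "(b, a) \<in> crossers K n x y" using left[of a b] meet ab by (auto simp: crossers_def)
        then have "(\<lambda>(u, v). {u, v}) (b, a) \<in> (\<lambda>(u, v). {u, v}) ` crossers K n x y" by (rule imageI)
        then show ?thesis using ab by (simp add: insert_commute)
      qed
    qed
  qed
  then show ?thesis by (simp add: bij_betw_same_card)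
qed

text \<open>Reduces the theorem to combinatorics: it remains to choose \<open>K\<close> for given
  \<open>n\<close> and \<open>k\<close>.\<close>

lemma avoiding_drawing:
  assumes "\<And>x y. x < y \<Longrightarrow> y < n \<Longrightarrow> card (crossers K n x y) \<noteq> k"
  shows "\<exists>p. rectilinear_drawing {..<n} (complete_edges n) p \<and> e_count k (complete_edges n) p = 0"
proof -
  obtain h where h: "kink_pattern K h n" "no_triple h n" using kink_drawing_exists .
  note gen = kink_pattern_generic[OF h(1)]
  have "num_crossings (complete_edges n) (pt h) e \<noteq> k" if mem: "e \<in> complete_edges n" for e
  proof -
    obtain x y where "x < y" "y < n" "e = {x, y}" by (rule complete_edgesE[OF mem])
    then show ?thesis
      using num_crossings_card_edges[OF gen h(2) mem] card_crossing_edges[OF h(1)] assms by auto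
  qed
  then have "{e \<in> complete_edges n. num_crossings (complete_edges n) (pt h) e = k} = {}" by blast
  then have "e_count k (complete_edges n) (pt h) = 0" unfolding e_count_def by (metis card.empty)
  then show ?thesis using generic_drawing[OF gen h(2)] by blast
qed

section \<open>Counting crossings\<close>

text \<open>The cardinality is the number \<open>c y\<close> of the introduction. A hidden pair
  interleaves with every kinked edge ending at \<open>y\<close> but, being kink-free itself, does
  not cross it.\<close>

definition hidden :: "nat set \<Rightarrow> nat \<Rightarrow> nat \<Rightarrow> (nat \<times> nat) set" where
  "hidden K n y = {(u, v). u < y \<and> y < v \<and> v < n \<and> K \<inter> {u<..<v} = {}}"

definition kink_spacing :: "nat set \<Rightarrow> nat \<Rightarrow> nat \<Rightarrow> bool" where
  "kink_spacing K n g \<longleftrightarrow> (\<forall>u v. u < v \<longrightarrow> v < n \<longrightarrow> K \<inter> {u<..<v} = {} \<longrightarrow> v - u \<le> g)"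

lemma finite_hidden: "finite (hidden K n y)"
  by (rule finite_subset[of _ "{..<y} \<times> {..<n}"]) (auto simp: hidden_def)

text \<open>The right-hand side counts the pairs of a vertex inside \<open>xy\<close> and a vertex
  outside. Those that do not cross are kink-free; such a pair reaches over exactly one end of
  \<open>xy\<close> and is hidden there.\<close>

lemma card_crossers:
  assumes "x < y" "y < n" "K \<inter> {x<..<y} \<noteq> {}"
  shows "card (crossers K n x y) + card (hidden K n x) + card (hidden K n y)
    = (y - x - 1) * (n - 2 - (y - x - 1))"
proof -
  let ?T = "{x<..<y} \<times> ({..<x} \<union> {y<..<n})"
  \<comment> \<open>Pairs hidden at \<open>x\<close> have their inner end on the right, whereas
    \<open>crossers\<close> lists the inner end first.\<close>
  let ?X = "prod.swap ` hidden K n x"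
  \<comment> \<open>A hidden pair cannot reach over the kink \<open>t\<close>, so one of its ends
    stays inside \<open>xy\<close>.\<close>
  obtain t where t: "t \<in> K" "x < t" "t < y" using assms(3) by auto
  have hx: "v < y" if "(u, v) \<in> hidden K n x" for u v
  proof (rule ccontr)
    assume "\<not> v < y"
    then have "t \<in> K \<inter> {u<..<v}" using t that by (auto simp: hidden_def)
    then show False using that by (auto simp: hidden_def)
  qed
  have hy: "x < u" if "(u, v) \<in> hidden K n y" for u v
  proof (rule ccontr)
    assume "\<not> x < u"
    then have "t \<in> K \<inter> {u<..<v}" using t that by (auto simp: hidden_def)
    then show False using that by (auto simp: hidden_def)
  qed
  have T: "?T = crossers K n x y \<union> (?X \<union> hidden K n y)"
  proof (intro equalityI subsetI)
    fix p assume "p \<in> ?T"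
    then obtain u v where p: "p = (u, v)" "x < u" "u < y" "v < x \<or> y < v" "v < n"
      using assms by (cases p) auto
    show "p \<in> crossers K n x y \<union> (?X \<union> hidden K n y)"
    proof (cases "K \<inter> {min u v<..<max u v} = {}")
      case False
      then have "p \<in> crossers K n x y" using p assms(3) by (simp add: crossers_def)
      then show ?thesis by blast
    next
      case True
      from p(4) show ?thesis
      proof
        assume "v < x"
        then have "(v, u) \<in> hidden K n x" using True p assms by (simp add: hidden_def min_def max_def)
        then have "p \<in> ?X" unfolding p(1) by (metis imageI swap_simp)
        then show ?thesis by blast
      next
        assume "y < v"
        then have "p \<in> hidden K n y" using True p assms by (simp add: hidden_def min_def max_def)
        then show ?thesis by blast
      qed
    qed
  next
    fix p assume "p \<in> crossers K n x y \<union> (?X \<union> hidden K n y)"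
    then consider "p \<in> crossers K n x y" | "p \<in> ?X" | "p \<in> hidden K n y" by blast
    then show "p \<in> ?T"
    proof cases
      case 1 then show ?thesis by (auto simp: crossers_def)
    next
      case 2
      then obtain u v where "p = (v, u)" "(u, v) \<in> hidden K n x" by auto
      then show ?thesis using hx[of u v] by (simp add: hidden_def)
    next
      case 3
      obtain u v where "p = (u, v)" by (cases p)
      then show ?thesis using 3 hy[of u v] by (simp add: hidden_def)
    qed
  qed
  have fin: "finite ?T" by simp
  have dj1: "crossers K n x y \<inter> (?X \<union> hidden K n y) = {}"
  proof -
    have "(u, v) \<notin> crossers K n x y" if "(v, u) \<in> hidden K n x" for u v
      using that assms(3) by (simp add: crossers_def hidden_def min_def max_def)
    moreover have "(u, v) \<notin> crossers K n x y" if "(u, v) \<in> hidden K n y" for u v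
      using that assms(3) by (simp add: crossers_def hidden_def min_def max_def)
    ultimately show ?thesis by fastforce
  qed
  have dj2: "?X \<inter> hidden K n y = {}" using assms(1) by (auto simp: hidden_def)
  have "card ?T = card (crossers K n x y) + (card ?X + card (hidden K n y))"
    using fin unfolding T by (subst card_Un_disjoint[OF _ _ dj1], simp_all)
      (subst card_Un_disjoint[OF _ _ dj2], simp_all)
  moreover have "card ?X = card (hidden K n x)" by (rule card_image) simp
  moreover have "card ?T = (y - x - 1) * (x + (n - 1 - y))"
  proof -
    have "card ({..<x} \<union> {y<..<n}) = x + (n - 1 - y)"
      using assms(1) by (subst card_Un_disjoint) auto
    then show ?thesis by (simp add: card_cartesian_product)
  qed
  moreover have "x + (n - 1 - y) = n - 2 - (y - x - 1)" using assms by simp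
  ultimately show ?thesis by simp
qed

text \<open>An edge crossing a kink-free \<open>xy\<close> is kink-free too, and the two overlap, so
  the interval they span is kink-free and has length at most \<open>g\<close>. This leaves at most
  \<open>g\<close> inner and \<open>2 * g\<close> outer ends.\<close>

lemma card_crossers_unkinked:
  assumes "kink_spacing K n g" "x < y" "y < n" "K \<inter> {x<..<y} = {}"
  shows "card (crossers K n x y) \<le> 2 * g ^ 2"
proof -
  have xy: "y - x \<le> g" using assms by (simp add: kink_spacing_def)
  have "crossers K n x y \<subseteq> {x<..<y} \<times> {y - g..x + g}"
  proof (rule subrelI)
    fix u v assume uv: "(u, v) \<in> crossers K n x y"
    then have K: "K \<inter> {min u v<..<max u v} = {}" and u: "x < u" "u < y" "v < n" and "v < x \<or> y < v"
      using assms(4) by (auto simp: crossers_def)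
    from \<open>v < x \<or> y < v\<close> show "(u, v) \<in> {x<..<y} \<times> {y - g..x + g}"
    proof
      assume v: "v < x"
      have "K \<inter> {v<..<y} = {}"
      proof (intro equals0I)
        fix t assume t: "t \<in> K \<inter> {v<..<y}"
        then have "t \<in> K \<inter> {min u v<..<max u v} \<or> t \<in> K \<inter> {x<..<y}" using u v by auto
        then show False using K assms(4) by blast
      qed
      then have "y - v \<le> g" using assms(1,3) u v by (simp add: kink_spacing_def)
      then have "y - g \<le> v" "v \<le> x + g" using u v by linarith+
      then show ?thesis using u v by simp
    next
      assume v: "y < v"
      have "K \<inter> {x<..<v} = {}"
      proof (intro equals0I)
        fix t assume t: "t \<in> K \<inter> {x<..<v}"
        then have "t \<in> K \<inter> {min u v<..<max u v} \<or> t \<in> K \<inter> {x<..<y}" using u v by auto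
        then show False using K assms(4) by blast
      qed
      then have "v - x \<le> g" using assms(1,3) u v by (simp add: kink_spacing_def)
      then have "y - g \<le> v" "v \<le> x + g" using u v by linarith+
      then show ?thesis using u v by simp
    qed
  qed
  then have "card (crossers K n x y) \<le> card ({x<..<y} \<times> {y - g..x + g})"
    by (intro card_mono) auto
  also have "\<dots> = (y - x - 1) * (Suc (x + g) - (y - g))"
    by (simp add: card_cartesian_product)
  \<comment> \<open>\<open>x < y\<close> absorbs the successor, also if \<open>y - g\<close> is
    truncated to 0.\<close>
  also have "\<dots> \<le> g * (2 * g)"
    using xy assms(2) by (intro mult_mono) auto
  finally show ?thesis by (simp add: power2_eq_square)
qed

lemma card_hidden_le:
  assumes "kink_spacing K n g"
  shows "card (hidden K n y) \<le> g ^ 2"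
proof -
  have "hidden K n y \<subseteq> {y - g..<y} \<times> {y<..y + g}"
  proof (rule subrelI)
    fix u v assume "(u, v) \<in> hidden K n y"
    then have uv: "u < y" "y < v" and "v - u \<le> g"
      using assms by (auto simp: hidden_def kink_spacing_def)
    then have "y - g \<le> u" "v \<le> y + g" by linarith+
    then show "(u, v) \<in> {y - g..<y} \<times> {y<..y + g}" using uv by simp
  qed
  then have "card (hidden K n y) \<le> card ({y - g..<y} \<times> {y<..y + g})"
    by (intro card_mono) auto
  also have "\<dots> = (y - (y - g)) * g" by (simp add: card_cartesian_product)
  also have "\<dots> \<le> g * g" by (intro mult_mono) auto
  finally show ?thesis by (simp add: power2_eq_square)
qed

text \<open>Every pair of a vertex in \<open>{s..<y}\<close> and one in \<open>{y<..t}\<close> is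
  hidden, and a product of two positive integers is at least their sum minus one.\<close>

lemma card_hidden_ge:
  assumes "s < y" "y < t" "t < n" "K \<inter> {s<..<t} = {}"
  shows "t - s - 1 \<le> card (hidden K n y)"
proof -
  have "{s..<y} \<times> {y<..t} \<subseteq> hidden K n y"
    using assms by (auto simp: hidden_def)
  then have "card ({s..<y} \<times> {y<..t}) \<le> card (hidden K n y)"
    by (intro card_mono finite_hidden)
  then have le: "(y - s) * (t - y) \<le> card (hidden K n y)" by (simp add: card_cartesian_product)
  obtain i where "y = Suc (s + i)" using less_imp_Suc_add[OF assms(1)] by blast
  moreover obtain j where "t = Suc (y + j)" using less_imp_Suc_add[OF assms(2)] by blast
  ultimately have "t - s - 1 \<le> (y - s) * (t - y)" by simp
  then show ?thesis using le by (rule order.trans)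
qed

lemma card_hidden_pos:
  assumes "y \<notin> K" "0 < y" "y < n - 1"
  shows "1 \<le> card (hidden K n y)"
proof -
  have "{y - 1<..<y + 1} = {y}" using assms(2) by auto
  then have "K \<inter> {y - 1<..<y + 1} = {}" using assms(1) by auto
  then show ?thesis using card_hidden_ge[of "y - 1" y "y + 1" n K] assms by simp
qed

section \<open>Kinks avoiding two given distances\<close>

text \<open>Induction over windows of length nine. For a fixed distance only two windows can hold an
  earlier kink that far from window \<open>J\<close>, so both distances exclude at most four
  positions; together with \<open>Z\<close> at most eight of nine are lost.\<close>

lemma sparse_kinks_prefix:
  fixes d e :: nat and Z :: "nat set"
  assumes "d > 0" "e > 0" "finite Z" "card Z \<le> 4"
  shows "\<exists>f. (\<forall>j<J. 9 * j \<le> f j \<and> f j < 9 * j + 9 \<and> f j \<notin> Z) \<and>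
    (\<forall>i j. i < j \<longrightarrow> j < J \<longrightarrow> f j \<noteq> f i + d \<and> f j \<noteq> f i + e)"
proof (induction J)
  case (Suc J)
  then obtain f where f: "\<And>j. j < J \<Longrightarrow> 9 * j \<le> f j \<and> f j < 9 * j + 9 \<and> f j \<notin> Z"
    and f2: "\<And>i j. i < j \<Longrightarrow> j < J \<Longrightarrow> f j \<noteq> f i + d \<and> f j \<noteq> f i + e"
    by blast
  let ?B = "{f (J - d div 9) + d, f (J - d div 9 - 1) + d, f (J - e div 9) + e, f (J - e div 9 - 1) + e}"
  have "card (?B \<union> Z) \<le> card ?B + card Z" by (rule card_Un_le)
  also have "card ?B \<le> 4" by (simp add: card_insert_if)
  finally have "card (?B \<union> Z) < card {9 * J..<9 * J + 9}" using assms(4) by simp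
  then have "\<not> {9 * J..<9 * J + 9} \<subseteq> ?B \<union> Z"
    using card_mono[of "?B \<union> Z" "{9 * J..<9 * J + 9}"] assms(3) by auto
  then obtain x where "x \<in> {9 * J..<9 * J + 9}" and x_new: "x \<notin> ?B" "x \<notin> Z" by blast
  then have x: "9 * J \<le> x" "x < 9 * J + 9" by simp_all
  have idx: "i = J - c div 9 \<or> i = J - c div 9 - 1" if "i < J" "x = f i + c" for i c
  proof -
    obtain q r where q: "c div 9 = q" and r: "c = 9 * q + r" "r < 9"
      using that[of "c div 9" "c mod 9"] by simp
    have "9 * i \<le> f i" "f i < 9 * i + 9" using f[OF that(1)] by auto
    with r have "9 * (i + q) \<le> f i + c" "f i + c < 9 * (i + q) + 18" by simp_all
    with x that(2) have "9 * (i + q) < 9 * (J + 1)" "9 * J < 9 * (i + q + 2)" by simp_all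
    then have "i + q = J \<or> i + q + 1 = J" unfolding mult_less_cancel1 by linarith
    then show ?thesis unfolding q by auto
  qed
  have new: "x \<noteq> f i + d \<and> x \<noteq> f i + e" if "i < J" for i
    using idx[OF that, of d] idx[OF that, of e] x_new(1) by auto
  have "\<forall>j<Suc J. 9 * j \<le> (f(J := x)) j \<and> (f(J := x)) j < 9 * j + 9 \<and> (f(J := x)) j \<notin> Z"
    using f x x_new(2) by (auto simp: less_Suc_eq)
  moreover have "\<forall>i j. i < j \<longrightarrow> j < Suc J \<longrightarrow>
      (f(J := x)) j \<noteq> (f(J := x)) i + d \<and> (f(J := x)) j \<noteq> (f(J := x)) i + e"
    using f2 new by (auto simp: less_Suc_eq)
  ultimately show ?case by blast
qed auto

text \<open>
  Greedily picking one kink from each window of nine positions works: at most four positions of a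
  window are at a forbidden distance from earlier kinks, at most four more from \<open>0\<close> or \<open>n - 1\<close>.
\<close>

lemma sparse_kinks_exist:
  assumes "2 \<le> d" "d + 2 \<le> n"
  obtains K where "kink_spacing K n 18"
    "\<And>s t. s \<in> insert 0 (insert (n - 1) K) \<Longrightarrow> t \<in> insert 0 (insert (n - 1) K) \<Longrightarrow>
       s < t \<Longrightarrow> t < n \<Longrightarrow> t - s \<noteq> d \<and> t - s \<noteq> n - d"
proof -
  let ?e = "n - d"
  let ?Z = "{d, ?e, n - 1 - d, n - 1 - ?e}"
  have Z: "finite ?Z" "card ?Z \<le> 4" by (simp_all add: card_insert_if)
  have "d > 0" "?e > 0" using assms by auto
  from sparse_kinks_prefix[OF this Z, of n] obtain f where
    F: "(\<forall>j<n. 9 * j \<le> f j \<and> f j < 9 * j + 9 \<and> f j \<notin> ?Z) \<and>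
      (\<forall>i j. i < j \<longrightarrow> j < n \<longrightarrow> f j \<noteq> f i + d \<and> f j \<noteq> f i + ?e)"
    by (elim exE)
  note f = F[THEN conjunct1, rule_format] and f2 = F[THEN conjunct2, rule_format]
  \<comment> \<open>Windows with \<open>j < n\<close> reach past the last vertex; kinks there lie
    strictly inside no edge.\<close>
  define K where "K = f ` {..<n}"
  have "kink_spacing K n 18" unfolding kink_spacing_def
  proof (intro allI impI, rule ccontr)
    fix u v assume uv: "u < v" "v < n" "K \<inter> {u<..<v} = {}" "\<not> v - u \<le> 18"
    \<comment> \<open>The window after the one containing \<open>u\<close> starts to the right of
      \<open>u\<close> and ends by \<open>u + 18\<close>, whence the spacing 18.\<close>
    define j where "j = u div 9 + 1"
    have "u = 9 * (u div 9) + u mod 9" "u mod 9 < 9" by simp_all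
    then have j1: "u < 9 * j" "9 * j + 9 \<le> u + 18" unfolding j_def distrib_left by linarith+
    then have j: "j < n" using uv by linarith
    have "9 * j \<le> f j" "f j < 9 * j + 9" using f[OF j] by auto
    then have "u < f j" "f j < v" using j1 uv by linarith+
    moreover have "f j \<in> K" using j by (simp add: K_def)
    ultimately show False using uv(3) by auto
  qed
  moreover have "t - s \<noteq> d \<and> t - s \<noteq> ?e"
    if st: "s \<in> insert 0 (insert (n - 1) K)" "t \<in> insert 0 (insert (n - 1) K)" "s < t" "t < n" for s t
  proof -
    have s: "s = 0 \<or> s \<in> K" and t: "t = n - 1 \<or> t \<in> K" using st by auto
    have Z: "r \<noteq> d \<and> r \<noteq> ?e \<and> r \<noteq> n - 1 - d \<and> r \<noteq> n - 1 - ?e" if "r \<in> K" for r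
      using that f unfolding K_def by auto
    consider "s \<in> K" "t \<in> K" | "s = 0" "t = n - 1" | "s = 0" "t \<in> K" | "s \<in> K" "t = n - 1"
      using s t by blast
    then show ?thesis
    proof cases
      case 1
      then obtain i j where ij: "i < n" "s = f i" "j < n" "t = f j" unfolding K_def by auto
      have "i < j"
        using f[OF ij(1)] f[OF ij(3)] ij st(3) by (cases i j rule: linorder_cases) auto
      then show ?thesis using f2[OF _ ij(3), of i] ij st(3) by auto
    next
      case 2 then show ?thesis using assms by auto
    next
      case 3 then show ?thesis using Z[of t] by auto
    next
      case 4 then show ?thesis using Z[of s] st(3) by auto
    qed
  qed
  ultimately show ?thesis using that by blast
qed

section \<open>The three ranges of \<open>k\<close>\<close>

text \<open>With kinks everywhere no pair is hidden, so an edge with \<open>b\<close> vertices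
  inside has exactly \<open>b * (n - 2 - b)\<close> crossings; neighbouring vertices give 0,
  excluded by \<open>k \<ge> 1\<close>.\<close>

lemma convex_avoids:
  assumes "k \<ge> 1" "\<And>a. k \<noteq> a * (n - 2 - a)" "x < y" "y < n"
  shows "card (crossers UNIV n x y) \<noteq> k"
proof (cases "y = x + 1")
  case True
  then have "crossers UNIV n x y = {}" by (auto simp: crossers_def)
  then show ?thesis using assms(1) by simp
next
  case False
  then have "x + 1 \<in> UNIV \<inter> {x<..<y}" using assms(3) by auto
  then have ne: "UNIV \<inter> {x<..<y} \<noteq> {}" by blast
  have "hidden UNIV n z = {}" for z by (auto simp: hidden_def)
  then show ?thesis using card_crossers[OF assms(3,4) ne] assms(2)[of "y - x - 1"] by auto
qed

text \<open>Used with \<open>m = n - 2\<close>: the factors show that \<open>b * (m - b)\<close>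
  exceeds the value at \<open>a\<close> only for \<open>b\<close> strictly between \<open>a\<close>
  and \<open>m - a\<close>, provided \<open>2 * a \<le> m\<close>.\<close>

lemma product_diff:
  fixes a b m :: int
  shows "b * (m - b) - a * (m - a) = (b - a) * (m - a - b)"
  by (simp add: algebra_simps)

text \<open>Hidden pairs lower the value \<open>b * (n - 2 - b)\<close> by
  \<open>h \<le> 648 = 2 * 18 ^ 2\<close>. For \<open>b = a\<close> and \<open>b = n - 2 - a\<close>
  this value is \<open>k\<close>, but \<open>h \<ge> 1\<close>. For \<open>b\<close> outside that
  range it is below \<open>k\<close> already; strictly inside it is at least 649 above
  \<open>k\<close>, by the margin 650.\<close>

lemma sparse_avoids:
  assumes "1 \<le> a" "2 * a + 650 \<le> n - 2" "k = a * (n - 2 - a)"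
  obtains K where "\<And>x y. x < y \<Longrightarrow> y < n \<Longrightarrow> card (crossers K n x y) \<noteq> k"
proof -
  have n: "2 \<le> a + 1" "a + 1 + 2 \<le> n" using assms by auto
  obtain K where K: "kink_spacing K n 18"
    and diff: "\<And>s t. s \<in> insert 0 (insert (n - 1) K) \<Longrightarrow> t \<in> insert 0 (insert (n - 1) K) \<Longrightarrow>
       s < t \<Longrightarrow> t < n \<Longrightarrow> t - s \<noteq> a + 1 \<and> t - s \<noteq> n - (a + 1)"
    using sparse_kinks_exist[OF n] by blast
  \<comment> \<open>Edges with no kink inside have at most \<open>2 * 18 ^ 2 = 648\<close>
    crossings.\<close>
  have k: "k > 648"
  proof -
    have "1 * 649 \<le> a * (n - 2 - a)" using assms(1,2) by (intro mult_mono) auto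
    then show ?thesis using assms(3) by simp
  qed
  have "card (crossers K n x y) \<noteq> k" if xy: "x < y" "y < n" for x y
  proof (cases "K \<inter> {x<..<y} = {}")
    case True
    then show ?thesis using card_crossers_unkinked[OF K xy] k by simp
  next
    case False
    define b where "b = y - x - 1"
    define h where "h = card (hidden K n x) + card (hidden K n y)"
    have bn: "b \<le> n - 2" using xy by (simp add: b_def)
    have eq: "card (crossers K n x y) + h = b * (n - 2 - b)"
      using card_crossers[OF xy False] by (simp add: b_def h_def)
    have h_le: "h \<le> 648"
      using card_hidden_le[OF K, of x] card_hidden_le[OF K, of y] by (simp add: h_def)
    \<comment> \<open>An edge has length \<open>b + 1\<close>, so the critical lengths are
      \<open>a + 1\<close> and \<open>n - (a + 1)\<close>, the distances avoided by the kinks and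
      the two extreme vertices.\<close>
    have h_pos: "h \<ge> 1" if "b = a \<or> b = n - 2 - a"
    proof -
      have "y - x = a + 1 \<or> y - x = n - (a + 1)" using that xy assms(2) by (auto simp: b_def)
      then have "x \<notin> insert 0 (insert (n - 1) K) \<or> y \<notin> insert 0 (insert (n - 1) K)"
        using diff xy by blast
      moreover have "1 \<le> card (hidden K n x)" if "x \<notin> insert 0 (insert (n - 1) K)"
        using card_hidden_pos[of x K n] that xy by auto
      moreover have "1 \<le> card (hidden K n y)" if "y \<notin> insert 0 (insert (n - 1) K)"
        using card_hidden_pos[of y K n] that xy by auto
      ultimately show ?thesis unfolding h_def by linarith
    qed
    show ?thesis
    proof
      assume k_eq: "card (crossers K n x y) = k"
      have "int (n - 2 - a) = int (n - 2) - int a" "int (n - 2 - b) = int (n - 2) - int b"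
        using assms(2) bn by (intro of_nat_diff; linarith)+
      then have kint: "int k = int a * (int (n - 2) - int a)"
        and "int (card (crossers K n x y) + h) = int b * (int (n - 2) - int b)"
        unfolding eq assms(3) by (simp_all only: of_nat_mult)
      then have h_eq: "int h = (int b - int a) * (int (n - 2) - int a - int b)"
        unfolding product_diff[symmetric] using kint k_eq by simp
      consider "b = a \<or> b = n - 2 - a" | "b < a" | "n - 2 - a < b" | "a < b" "b < n - 2 - a"
        by linarith
      then show False
      proof cases
        case 1
        then have "int h = 0" unfolding h_eq using assms(2) by (auto simp: of_nat_diff)
        then show False using h_pos[OF 1] by simp
      next
        case 2
        then have "int h < 0" unfolding h_eq using assms(2) by (intro mult_neg_pos) auto
        then show False by simp
      next
        case 3
        then have "int h < 0" unfolding h_eq using assms(2) by (intro mult_pos_neg) auto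
        then show False by simp
      next
        case 4
        \<comment> \<open>Both factors are positive with a sum of at least 650, so their product is
          at least 649.\<close>
        then obtain p q where pq: "int b - int a = 1 + int p" "int (n - 2) - int a - int b = 1 + int q"
          using that[of "b - a - 1" "n - 2 - a - b - 1"] by (auto simp: of_nat_diff)
        have "int p + int q + 2 = int (n - 2) - 2 * int a" using pq by linarith
        then have "int p + int q \<ge> 648" using assms(2) by linarith
        moreover have "int h = 1 + int p + int q + int p * int q"
          unfolding h_eq pq by (simp add: algebra_simps)
        moreover have "int p * int q \<ge> 0" by simp
        ultimately have "int h \<ge> 649" by linarith
        then show False using h_le by simp
      qed
    qed
  qed
  then show ?thesis using that by blast
qed

text \<open>Here \<open>k\<close> is within \<open>649 ^ 2 / 4\<close> of \<open>m ^ 2 / 4\<close>.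
  Kink-free edges have at most about \<open>2 * n ^ 2 / 9\<close> crossings, too few. Any other edge
  with \<open>k\<close> crossings has length close to \<open>n / 2\<close> and a small
  \<open>h\<close>; but then one of its ends avoids \<open>0\<close>, \<open>q\<close>,
  \<open>2 * q\<close> and \<open>n - 1\<close>, which yields at least \<open>q - 2\<close> hidden
  pairs.\<close>

lemma three_chains_avoid:
  assumes "n \<ge> 1000000" "2 * a \<le> n - 2" "n - 2 < 2 * a + 650" "k = a * (n - 2 - a)"
    "x < y" "y < n"
  shows "card (crossers {n div 3, 2 * (n div 3)} n x y) \<noteq> k"
proof
  define q where "q = n div 3"
  define m where "m = int (n - 2)"
  define K where "K = {q, 2 * q}"
  assume "card (crossers {n div 3, 2 * (n div 3)} n x y) = k"
  then have k_eq: "card (crossers K n x y) = k" by (simp add: K_def q_def)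
  have q: "3 * q \<le> n" "n \<le> 3 * q + 2" unfolding q_def by presburger+
  have "kink_spacing K n (q + 2)"
    unfolding kink_spacing_def
  proof (intro allI impI)
    fix u v assume uv: "u < v" "v < n" "K \<inter> {u<..<v} = {}"
    then have "\<not> (u < q \<and> q < v)" "\<not> (u < 2 * q \<and> 2 * q < v)" by (auto simp: K_def)
    then show "v - u \<le> q + 2" using uv(1,2) q by linarith
  qed
  note spacing = this
  have "int (n - 2 - a) = m - int a" unfolding m_def using assms(2) by (intro of_nat_diff) linarith
  then have "int k = int a * (m - int a)" unfolding assms(4) by (simp only: of_nat_mult)
  \<comment> \<open>Completing the square turns closeness of \<open>a\<close> to
    \<open>m / 2\<close> into the error bound \<open>649 ^ 2 = 421201\<close>.\<close>
  then have kint: "4 * int k = m ^ 2 - (m - 2 * int a) ^ 2"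
    by (simp add: power2_eq_square algebra_simps)
  have "\<bar>m - 2 * int a\<bar> \<le> 649" using assms(2,3) by (auto simp: m_def)
  then have "(m - 2 * int a) ^ 2 \<le> 649 ^ 2" by (metis abs_le_square_iff abs_numeral)
  then have defect: "(m - 2 * int a) ^ 2 \<le> 421201" by simp
  show False
  proof (cases "K \<inter> {x<..<y} = {}")
    case True
    then have "k \<le> 2 * (q + 2) ^ 2" using card_crossers_unkinked[OF spacing assms(5,6)] k_eq by simp
    then have "int k \<le> int (2 * (q + 2) ^ 2)" by (simp only: of_nat_le_iff)
    then have "int k \<le> 2 * (int q + 2) ^ 2"
      by (simp only: of_nat_mult of_nat_power of_nat_add of_nat_numeral)
    then have "m ^ 2 \<le> 8 * (int q + 2) ^ 2 + 421201" using kint defect by linarith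
    moreover have m: "3 * (int q + 2) \<le> m + 8" "m \<ge> 999998" using q assms(1) by (auto simp: m_def)
    have "(3 * (int q + 2)) ^ 2 \<le> (m + 8) ^ 2" using m(1) by (intro power_mono) auto
    then have "9 * (int q + 2) ^ 2 \<le> (m + 8) ^ 2" unfolding power_mult_distrib by simp
    \<comment> \<open>Since \<open>2 / 9 < 1 / 4\<close>, the leading terms contradict each other
      for large \<open>m\<close>.\<close>
    ultimately have "9 * m ^ 2 \<le> 8 * (m + 8) ^ 2 + 9 * 421201" by linarith
    then have "m * (m - 128) \<le> 8 * 64 + 9 * 421201" by (simp add: power2_eq_square algebra_simps)
    moreover have "999998 * 999870 \<le> m * (m - 128)" using m(2) by (intro mult_mono) auto
    ultimately show False by simp
  next
    case False
    define b where "b = y - x - 1"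
    define h where "h = card (hidden K n x) + card (hidden K n y)"
    have bn: "b \<le> n - 2" using assms(5,6) by (simp add: b_def)
    have "card (crossers K n x y) + h = b * (n - 2 - b)"
      using card_crossers[OF assms(5,6) False] by (simp add: b_def h_def)
    then have "int k + int h = int b * int (n - 2 - b)"
      unfolding k_eq by (simp only: of_nat_add[symmetric] of_nat_mult[symmetric])
    also have "int (n - 2 - b) = m - int b" unfolding m_def using bn by (rule of_nat_diff)
    finally have "int k + int h = int b * (m - int b)" .
    then have "4 * int k + 4 * int h = m ^ 2 - (m - 2 * int b) ^ 2"
      by (simp add: power2_eq_square algebra_simps)
    then have h_eq: "4 * int h + (m - 2 * int b) ^ 2 = (m - 2 * int a) ^ 2" using kint by linarith
    then have "(m - 2 * int b) ^ 2 \<le> 649 ^ 2" using defect by simp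
    then have mb: "\<bar>m - 2 * int b\<bar> \<le> 649" by (metis abs_le_square_iff abs_numeral)
    \<comment> \<open>Each of the three kink-free stretches between \<open>0\<close>,
      \<open>q\<close>, \<open>2 * q\<close> and \<open>n - 1\<close> has length at least
      \<open>q - 1\<close>.\<close>
    have hidden_ge: "q - 2 \<le> card (hidden K n z)" if z: "z < n" "z \<notin> {0, q, 2 * q, n - 1}" for z
    proof -
      have "0 < z" "z \<noteq> q" "z \<noteq> 2 * q" "z < n - 1" using z by auto
      then consider "0 < z" "z < q" | "q < z" "z < 2 * q" | "2 * q < z" "z < n - 1"
        by linarith
      then show ?thesis
      proof cases
        case 1
        then show ?thesis using card_hidden_ge[of 0 z q n K] q by (auto simp: K_def)
      next
        case 2
        then show ?thesis using card_hidden_ge[of q z "2 * q" n K] q by (auto simp: K_def)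
      next
        case 3
        then show ?thesis using card_hidden_ge[of "2 * q" z "n - 1" n K] q by (auto simp: K_def)
      qed
    qed
    have "int b = int y - int x - 1" using assms(5) by (simp add: b_def of_nat_diff)
    moreover have "m = int n - 2" using assms(1) by (simp add: m_def of_nat_diff)
    ultimately have "\<bar>int n - 2 * (int y - int x)\<bar> \<le> 649" using mb by simp
    \<comment> \<open>Differences of these four numbers are near \<open>n / 3\<close>,
      \<open>2 * n / 3\<close> or \<open>n\<close>, whereas \<open>y - x\<close> is within 325 of
      \<open>n / 2\<close>.\<close>
    then have "x \<notin> {0, q, 2 * q, n - 1} \<or> y \<notin> {0, q, 2 * q, n - 1}"
      using q assms(1,5) by (auto simp: of_nat_diff)
    then have "q - 2 \<le> h"
      using hidden_ge[of x] hidden_ge[of y] assms(5,6) unfolding h_def by fastforce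
    then have "q \<le> h + 2" by simp
    moreover have "4 * int h \<le> 421201"
      using h_eq defect zero_le_power2[of "m - 2 * int b"] by linarith
    ultimately show False using q assms(1) by linarith
  qed
qed

lemma avoiding_kinks_exist:
  assumes "n \<ge> 1000000" "k \<ge> 1"
  obtains K where "\<And>x y. x < y \<Longrightarrow> y < n \<Longrightarrow> card (crossers K n x y) \<noteq> k"
proof (cases "\<exists>a. k = a * (n - 2 - a)")
  case False
  then show ?thesis using convex_avoids[OF assms(2)] that by blast
next
  case True
  \<comment> \<open>The product is symmetric under exchanging \<open>a\<close> with
    \<open>n - 2 - a\<close>; \<open>k \<ge> 1\<close> excludes truncation in the
    subtraction.\<close>
  have "\<exists>a. k = a * (n - 2 - a) \<and> 2 * a \<le> n - 2"
  proof -
    obtain a where a: "k = a * (n - 2 - a)" using True by blast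
    then have "n - 2 - a > 0" using assms(2) by (metis gr0I mult_0_right not_one_le_zero)
    then have "k = (n - 2 - a) * (n - 2 - (n - 2 - a))" using a by simp
    moreover have "2 * a \<le> n - 2 \<or> 2 * (n - 2 - a) \<le> n - 2" by linarith
    ultimately show ?thesis using a by blast
  qed
  then obtain a where a: "k = a * (n - 2 - a)" "2 * a \<le> n - 2" by blast
  have "1 \<le> a" using a(1) assms(2) by (cases a) auto
  show ?thesis
  proof (cases "2 * a + 650 \<le> n - 2")
    case True
    then show ?thesis using sparse_avoids[OF \<open>1 \<le> a\<close> _ a(1)] that by blast
  next
    case False
    then show ?thesis using three_chains_avoid[OF assms(1) a(2) _ a(1)] that by (metis not_le)
  qed
qed

lemma min_e_eq_0:
  assumes "rectilinear_drawing V E p" "e_count k E p = 0"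
  shows "min_e k V E = 0"
  unfolding min_e_def by (rule Least_eq_0) (use assms in blast)

theorem theorem4p1:
  shows "\<exists>N::nat. N > 0 \<and>
    (\<forall>k::nat. \<forall>n::nat. k \<ge> 1 \<longrightarrow> n \<ge> N \<longrightarrow>
       min_e k {..<n} (complete_edges n) = 0 \<and>
       (\<exists>p. rectilinear_drawing {..<n} (complete_edges n) p \<and>
            e_count k (complete_edges n) p = 0))"
\<comment> \<open>The construction with two kinks needs a third of \<open>n\<close> to exceed about
  \<open>649 ^ 2 / 4\<close>; this bound leaves ample room.\<close>
proof (intro exI[of _ 1000000] conjI allI impI)
  show "(1000000 :: nat) > 0" by simp
  fix k n :: nat assume "k \<ge> 1" "n \<ge> 1000000"
  then obtain K where "\<And>x y. x < y \<Longrightarrow> y < n \<Longrightarrow> card (crossers K n x y) \<noteq> k"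
    using avoiding_kinks_exist[of n k] by metis
  then have ex: "\<exists>p. rectilinear_drawing {..<n} (complete_edges n) p \<and>
      e_count k (complete_edges n) p = 0"
    by (rule avoiding_drawing)
  show "\<exists>p. rectilinear_drawing {..<n} (complete_edges n) p \<and>
      e_count k (complete_edges n) p = 0" by (rule ex)
  show "min_e k {..<n} (complete_edges n) = 0" using ex min_e_eq_0 by metis
qed

end
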